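(* Let $\mathbb{X}$ be a vector lattice and $x_0,x_1,x_2,y_1,y_2\in\mathbb{X}$. If $x_1\sim_{x_0}y_1$ and $x_2\sim_{x_0}y_2$, then $x_1+x_2\sim_{x_0}y_1+y_2$ and $x_1-x_2\sim_{x_0}y_1-y_2$.
   Context: A vector lattice (Riesz space) is a real ordered vector space in which the supremum of any pair of elements exists; $|x|=\sup\{x,-x\}$. For $x,y\ge 0$, $x\perp y$ means $|x-y|=x+y$; for arbitrary $x,y\in\mathbb{X}$, $x\perp y$ means $|x|\perp|y|$. For $x_0,x,y\in\mathbb{X}$, $x\sim_{x_0}y$ (strong relation) means $(x-y)\perp x_0$. *)

theory Defs
  imports Complex_Main
begin

text \<open>
  Only binary suprema are required, since infima then exist automatically:
  \<open>- sup (- x) (- y)\<close> is the infimum of \<open>x\<close> and \<open>y\<close>.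
  The axiom for \<open>abs\<close> is the one used in \<open>HOL-Library.Lattice_Algebras\<close>; it determines
  \<open>abs\<close>, so no further structure is imposed.
\<close>

class vector_lattice = ordered_real_vector + semilattice_sup + abs +
  assumes abs_eq_sup: "\<bar>x\<bar> = sup x (- x)"

definition pos_disjoint :: "'a::vector_lattice \<Rightarrow> 'a \<Rightarrow> bool"
  where "pos_disjoint x y \<longleftrightarrow> \<bar>x - y\<bar> = x + y" \<comment> \<open>meant for \<open>0 \<le> x\<close> and \<open>0 \<le> y\<close> only\<close>

definition vl_disjoint :: "'a::vector_lattice \<Rightarrow> 'a \<Rightarrow> bool"
  where "vl_disjoint x y \<longleftrightarrow> pos_disjoint \<bar>x\<bar> \<bar>y\<bar>"

definition strongly_related :: "'a::vector_lattice \<Rightarrow> 'a \<Rightarrow> 'a \<Rightarrow> bool"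
  where "strongly_related x0 x y \<longleftrightarrow> vl_disjoint (x - y) x0"

text \<open>
  Absolute values are positive, so \<open>pos_disjoint\<close> is only used inside its intended domain,
  and there the two notions of disjointness agree.
\<close>

lemma vl_abs_nonneg: "0 \<le> \<bar>x\<bar>" for x :: "'a::vector_lattice"
proof -
  have "x + - x \<le> \<bar>x\<bar> + \<bar>x\<bar>"
    unfolding abs_eq_sup by (intro add_mono sup_ge1 sup_ge2)
  then have "0 \<le> 2 *\<^sub>R \<bar>x\<bar>"
    by (simp add: scaleR_2)
  then have "(1 / 2) *\<^sub>R 0 \<le> (1 / 2) *\<^sub>R (2 *\<^sub>R \<bar>x\<bar>)"
    by (intro scaleR_left_mono) simp_all
  then show ?thesis
    by simp
qed

lemma vl_abs_of_nonneg: "\<bar>x\<bar> = x" if "0 \<le> x" for x :: "'a::vector_lattice"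
proof -
  have "- x \<le> x"
    using that by (meson neg_le_0_iff_le order_trans)
  then show ?thesis
    by (simp add: abs_eq_sup sup_absorb1)
qed

lemma vl_disjoint_iff_pos_disjoint:
  "vl_disjoint x y \<longleftrightarrow> pos_disjoint x y" if "0 \<le> x" "0 \<le> y" for x y :: "'a::vector_lattice"
  using that by (simp add: vl_disjoint_def vl_abs_of_nonneg)

end

theory Submission
  imports Defs
begin

text \<open>
  Since \<open>\<bar>a - b\<bar> = a + b - 2 (a \<sqinter> b)\<close>, two positive elements are disjoint exactly when their infimum
  is \<open>0\<close>, that is, when every common lower bound of them is \<open>\<le> 0\<close>
  (\<open>pos_disjoint_iff_lower_bound\<close>). In this form it is visible that the elements disjoint from a
  fixed \<open>c\<close> are closed under sums: a lower bound of \<open>a + b\<close> and \<open>c\<close> can be pushed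
  below \<open>0\<close> by removing first \<open>a\<close> and then \<open>b\<close> (\<open>vl_disjoint_add\<close>). They are also closed under
  negation, so they form a subgroup. The strong relation is congruence modulo this subgroup, and
  hence compatible with addition and subtraction.
\<close>

lemma vl_abs_le_iff: "\<bar>x\<bar> \<le> b \<longleftrightarrow> x \<le> b \<and> - x \<le> b" for x :: "'a::vector_lattice"
  by (simp add: abs_eq_sup)

lemma vl_abs_minus: "\<bar>- x\<bar> = \<bar>x\<bar>" for x :: "'a::vector_lattice"
  by (simp add: abs_eq_sup sup_commute)

lemma vl_abs_triangle: "\<bar>x + y\<bar> \<le> \<bar>x\<bar> + \<bar>y\<bar>" for x y :: "'a::vector_lattice"
proof -
  have "x \<le> \<bar>x\<bar>" "- x \<le> \<bar>x\<bar>" "y \<le> \<bar>y\<bar>" "- y \<le> \<bar>y\<bar>"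
    by (simp_all add: abs_eq_sup)
  then have "x + y \<le> \<bar>x\<bar> + \<bar>y\<bar>" "- x + - y \<le> \<bar>x\<bar> + \<bar>y\<bar>"
    by (simp_all only: add_mono)
  then show ?thesis
    by (simp add: vl_abs_le_iff)
qed

lemma double_le_cancel: "x + x \<le> y + y \<Longrightarrow> x \<le> y" for x y :: "'a::ordered_real_vector"
  using scaleR_le_cancel_left_pos[of 2 x y] by (simp add: scaleR_2)

text \<open>
  This is \<open>a \<sqinter> b \<le> 0\<close> written without infima. The second half of the proof uses that
  \<open>(a + b - \<bar>a - b\<bar>) / 2\<close>, which is the infimum, is a lower bound of \<open>a\<close> and \<open>b\<close>.
\<close>

lemma pos_disjoint_iff_lower_bound:
  fixes a b :: "'a::vector_lattice"
  assumes "0 \<le> a" "0 \<le> b"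
  shows "pos_disjoint a b \<longleftrightarrow> (\<forall>z. z \<le> a \<longrightarrow> z \<le> b \<longrightarrow> z \<le> 0)"
proof
  assume disj: "pos_disjoint a b"
  show "\<forall>z. z \<le> a \<longrightarrow> z \<le> b \<longrightarrow> z \<le> 0"
  proof (intro allI impI)
    fix z assume "z \<le> a" "z \<le> b"
    then have "z + z \<le> a + a" "z + z \<le> b + b"
      by (simp_all add: add_mono)
    then have "a - b \<le> a + b - (z + z)" "b - a \<le> a + b - (z + z)"
      by (simp_all add: algebra_simps)
    then have "\<bar>a - b\<bar> \<le> a + b - (z + z)"
      by (simp add: vl_abs_le_iff)
    then have "z + z \<le> 0 + 0"
      using disj by (simp add: pos_disjoint_def le_diff_eq)
    then show "z \<le> 0"
      by (rule double_le_cancel)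
  qed
next
  assume lower: "\<forall>z. z \<le> a \<longrightarrow> z \<le> b \<longrightarrow> z \<le> 0"
  define z where "z = (1 / 2) *\<^sub>R (a + b - \<bar>a - b\<bar>)"
  have double_z: "z + z = a + b - \<bar>a - b\<bar>"
    unfolding z_def by (simp flip: scaleR_left_distrib)
  have "a - b \<le> \<bar>a - b\<bar>" "b - a \<le> \<bar>a - b\<bar>"
    using vl_abs_le_iff[of "a - b" "\<bar>a - b\<bar>"] by simp_all
  then have "z + z \<le> b + b" "z + z \<le> a + a"
    unfolding double_z by (simp_all add: algebra_simps)
  then have "z \<le> 0"
    using lower by (blast intro: double_le_cancel)
  then have "z + z \<le> 0 + 0"
    by (intro add_mono)
  then have "a + b \<le> \<bar>a - b\<bar>"
    by (simp add: double_z)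
  moreover have "\<bar>a - b\<bar> \<le> a + b"
    using vl_abs_triangle[of a "- b"] assms by (simp add: vl_abs_minus vl_abs_of_nonneg)
  ultimately show "pos_disjoint a b"
    by (simp add: pos_disjoint_def)
qed

lemma vl_disjoint_iff_lower_bound:
  "vl_disjoint x y \<longleftrightarrow> (\<forall>z. z \<le> \<bar>x\<bar> \<longrightarrow> z \<le> \<bar>y\<bar> \<longrightarrow> z \<le> 0)"
  for x y :: "'a::vector_lattice"
  by (simp add: vl_disjoint_def pos_disjoint_iff_lower_bound vl_abs_nonneg)

lemma vl_disjoint_minus: "vl_disjoint (- x) y \<longleftrightarrow> vl_disjoint x y" for x y :: "'a::vector_lattice"
  by (simp add: vl_disjoint_def vl_abs_minus)

text \<open>
  By the triangle inequality a common lower bound \<open>z\<close> of \<open>\<bar>x + y\<bar>\<close> and \<open>\<bar>w\<bar>\<close> is at most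
  \<open>\<bar>x\<bar> + \<bar>y\<bar>\<close>, so \<open>z - \<bar>y\<bar>\<close> is a common lower bound of \<open>\<bar>x\<bar>\<close> and \<open>\<bar>w\<bar>\<close>. Disjointness
  of \<open>x\<close> from \<open>w\<close> thus gives \<open>z \<le> \<bar>y\<bar>\<close>, and that of \<open>y\<close> from \<open>w\<close> gives \<open>z \<le> 0\<close>.
\<close>

lemma vl_disjoint_add:
  fixes x y w :: "'a::vector_lattice"
  assumes "vl_disjoint x w" "vl_disjoint y w"
  shows "vl_disjoint (x + y) w"
  unfolding vl_disjoint_iff_lower_bound
proof (intro allI impI)
  fix z assume z: "z \<le> \<bar>x + y\<bar>" "z \<le> \<bar>w\<bar>"
  have "z - \<bar>y\<bar> \<le> \<bar>x\<bar>"
    using order_trans[OF z(1) vl_abs_triangle] by (simp add: diff_le_eq)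
  moreover have "z - \<bar>y\<bar> \<le> \<bar>w\<bar>"
    using add_mono[OF z(2) vl_abs_nonneg[of y]] by (simp add: diff_le_eq)
  ultimately have "z - \<bar>y\<bar> \<le> 0"
    using assms(1) unfolding vl_disjoint_iff_lower_bound by blast
  then have "z \<le> \<bar>y\<bar>"
    by simp
  with z(2) show "z \<le> 0"
    using assms(2) by (simp add: vl_disjoint_iff_lower_bound)
qed

lemma vl_disjoint_diff:
  "vl_disjoint (x - y) w" if "vl_disjoint x w" "vl_disjoint y w" for x y w :: "'a::vector_lattice"
  using vl_disjoint_add[of x w "- y"] that by (simp add: vl_disjoint_minus)

theorem lemma3p5:
  fixes x0 x1 x2 y1 y2 :: "'a::vector_lattice"
  assumes "strongly_related x0 x1 y1"
    and "strongly_related x0 x2 y2"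
  shows "strongly_related x0 (x1 + x2) (y1 + y2) \<and>
    strongly_related x0 (x1 - x2) (y1 - y2)"
proof -
  have "x1 + x2 - (y1 + y2) = (x1 - y1) + (x2 - y2)"
    and "x1 - x2 - (y1 - y2) = (x1 - y1) - (x2 - y2)"
    by simp_all
  then show ?thesis
    using assms by (simp only: strongly_related_def vl_disjoint_add vl_disjoint_diff)
qed

end
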